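(* Let $1\le t\le n-1$, and let $S\subset\mathbb{F}_2^n$ be a linear code of block length $n$, dimension $d$ and minimal distance $t+1$. Let $\mathcal{B}_t=\{b_x : x\in\mathbb{F}_2^n\}$ be the $t$-th eigenconfiguration of the hypercube graph $H(n,2)$ and let $\pi$ be the coordinate projection of $\mathcal{B}_t$ onto the coordinates indexed by $y\in S$, $y\neq 0$. Then the convex hull of $\pi(\mathcal{B}_t)$ is a $(2^d-1)$-dimensional simplex with vertex set $\pi(\mathcal{B}_t)$. Moreover this produces a uniformly weighted design of $H(n,2)$ of strength $t$ with $2^{n-d}$ points which is the dual code of $S$: there is a vertex $p$ of this simplex such that $\{x\in\mathbb{F}_2^n : \pi(b_x)=p\}$ equals the dual code of $S$, and this set is a uniformly weighted design of strength $t$ with $2^{n-d}$ elements.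
   Context: The hypercube graph $H(n,2)$ has vertex set $\mathbb{F}_2^n$, with an edge between two vertices that differ in exactly one coordinate. For $y\in\mathbb{F}_2^n$, $|y|$ is the Hamming weight of $y$, and $\chi_y:\mathbb{F}_2^n\to\mathbb{R}$, $\chi_y(x)=(-1)^{y\cdot x}$, is an eigenvector of the Laplacian of $H(n,2)$ with eigenvalue $2|y|$. Hence the Laplacian eigenspaces, ordered by increasing eigenvalue, are $\Lambda_i=\operatorname{span}\{\chi_y:|y|=i\}$ for $i=0,\dots,n$, with $\dim\Lambda_i=\binom{n}{i}$. A subset $W\subset\mathbb{F}_2^n$ is a uniformly weighted design of strength $t$ if there is $a>0$ with $\frac{1}{2^n}\sum_{x\in\mathbb{F}_2^n}f(x)=a\sum_{w\in W}f(w)$ for all $f\in\Lambda_0\oplus\cdots\oplus\Lambda_t$. The $t$-th eigenconfiguration of $H(n,2)$ is the multiset of points $b_x=(\chi_y(x))_{y\in\mathbb{F}_2^n,\,|y|>t}$, $x\in\mathbb{F}_2^n$. A linear code with block length $n$ and minimal distance $t+1$ is a linear subspace $S\subset\mathbb{F}_2^n$ such that every nonzero $x\in S$ satisfies $|x|>t$; its dimension is its dimension as an $\mathbb{F}_2$-vector space. The dual code of $S$ is its orthogonal complement $\{x\in\mathbb{F}_2^n: x\cdot y=0 \text{ for all } y\in S\}$. *)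

theory Defs
  imports "HOL-Analysis.Analysis" "HOL-Library.Z2"
begin

text \<open>
  The space \<open>\<bbbF>\<^sub>2\<^sup>n\<close> is \<open>bit ^ 'n\<close> with \<open>n = CARD('n)\<close>; its linear algebra over \<open>\<bbbF>\<^sub>2\<close> is that of the
  interpretation \<open>vec\<close>. Real functions on \<open>\<bbbF>\<^sub>2\<^sup>n\<close> are vectors in \<open>real ^ (bit ^ 'n)\<close>.
\<close>

lemma UNIV_bit: "(UNIV :: bit set) = {0, 1}"
  by (metis (full_types) UNIV_eq_I bit_not_zero_iff insertCI)

instance bit :: finite
  by standard (simp add: UNIV_bit)

definition weight :: "bit ^ 'n::finite \<Rightarrow> nat" where
  "weight x = card {i. x $ i \<noteq> 0}"

definition hypercube_adj :: "bit ^ 'n::finite \<Rightarrow> bit ^ 'n \<Rightarrow> bool" where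
  "hypercube_adj x z \<longleftrightarrow> card {i. x $ i \<noteq> z $ i} = 1"

text \<open>The unnormalised Laplacian (degree matrix minus adjacency matrix) of a finite simple graph.\<close>

definition laplacian :: "('v \<Rightarrow> 'v \<Rightarrow> bool) \<Rightarrow> real ^ 'v::finite \<Rightarrow> real ^ 'v" where
  "laplacian adj f = (\<chi> x. \<Sum>z | adj x z. f $ x - f $ z)"

definition laplacian_eigenvalues :: "('v::finite \<Rightarrow> 'v \<Rightarrow> bool) \<Rightarrow> real set" where
  "laplacian_eigenvalues adj = {c. \<exists>f. f \<noteq> 0 \<and> laplacian adj f = c *\<^sub>R f}"

text \<open>
  The \<open>i\<close>-th Laplacian eigenspace of \<open>H(n,2)\<close>, counting from 0 in increasing order of the distinct
  eigenvalues; only \<open>i \<le> n\<close> is meaningful. It is spanned by the characters of weight \<open>i\<close>, see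
  \<open>hypercube_eigenspace_eq_span\<close> below.
\<close>

definition hypercube_eigenspace :: "nat \<Rightarrow> (real ^ (bit ^ 'n::finite)) set" where
  "hypercube_eigenspace i =
    {f. laplacian hypercube_adj f =
        (sorted_list_of_set (laplacian_eigenvalues (hypercube_adj :: bit ^ 'n \<Rightarrow> _)) ! i) *\<^sub>R f}"

definition character :: "bit ^ 'n::finite \<Rightarrow> real ^ (bit ^ 'n)" where
  "character y = (\<chi> x. (- 1) ^ (of_bit (scalar_product y x) :: nat))"

definition uniformly_weighted_design :: "nat \<Rightarrow> (bit ^ 'n::finite) set \<Rightarrow> bool" where
  "uniformly_weighted_design t W \<longleftrightarrow>
    (\<exists>a>0. \<forall>f \<in> {\<Sum>i\<le>t. g i | g. \<forall>i\<le>t. g i \<in> hypercube_eigenspace i}.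
      1 / 2 ^ CARD('n) * (\<Sum>x\<in>UNIV. f $ x) = a * (\<Sum>w\<in>W. f $ w))"

text \<open>
  For a set \<open>I\<close> of coordinates, \<open>\<real>\<^sup>I\<close> is identified with the vectors of \<open>real ^ 'k\<close> vanishing
  outside \<open>I\<close>, so the coordinate projection sets all other coordinates to 0.
\<close>

definition coord_proj :: "'k set \<Rightarrow> real ^ 'k::finite \<Rightarrow> real ^ 'k" where
  "coord_proj I v = (\<chi> y. if y \<in> I then v $ y else 0)"

text \<open>The point \<open>b\<^sub>x\<close>, living in \<open>\<real>\<^sup>I\<close> for \<open>I = {y. weight y > t}\<close>.\<close>

definition eigenpoint :: "nat \<Rightarrow> bit ^ 'n::finite \<Rightarrow> real ^ (bit ^ 'n)" where
  "eigenpoint t x = coord_proj {y. weight y > t} (\<chi> y. character y $ x)"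

definition eigenconfiguration :: "nat \<Rightarrow> (real ^ (bit ^ 'n::finite)) multiset" where
  "eigenconfiguration t = image_mset (eigenpoint t) (mset_set UNIV)"

text \<open>
  As usual for linear codes, \<open>\<delta>\<close> is a lower bound for the minimal distance, which need not be attained.
\<close>

definition linear_code :: "nat \<Rightarrow> (bit ^ 'n::finite) set \<Rightarrow> bool" where
  "linear_code \<delta> S \<longleftrightarrow> vec.subspace S \<and> (\<forall>x\<in>S. x \<noteq> 0 \<longrightarrow> weight x \<ge> \<delta>)"

definition dual_code :: "(bit ^ 'n::finite) set \<Rightarrow> (bit ^ 'n) set" where
  "dual_code S = {x. \<forall>y\<in>S. scalar_product x y = 0}"


text \<open>
  The characters are eigenvectors, the eigenvalues are \<open>0, 2, \<dots>, 2n\<close>, and the eigenspaces are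
  the spans of the characters of a given weight.
\<close>

lemma bit_vec_neg: "- x = (x :: bit ^ 'n::finite)"
  by (simp add: vec_eq_iff)

lemma bit_vec_add_self: "x + x = (0 :: bit ^ 'n::finite)"
  by (metis add.right_inverse bit_vec_neg)

lemma scalar_product_add_right:
  "scalar_product y (x + z) = scalar_product y x + scalar_product y (z :: bit ^ 'n::finite)"
  unfolding scalar_product_def by (simp only: vector_add_component distrib_left sum.distrib)

lemma scalar_product_commute:
  "scalar_product y x = scalar_product x (y :: bit ^ 'n::finite)"
  unfolding scalar_product_def by (intro sum.cong) (simp_all only: mult.commute)

lemma scalar_product_axis: "scalar_product y (axis i 1) = (y :: bit ^ 'n::finite) $ i"
  by (simp add: scalar_product_def axis_def if_distrib cong: if_cong)

lemma character_commute: "character y $ x = character x $ y"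
  by (simp add: character_def scalar_product_commute)

lemma character_add: "character y $ (x + z) = character y $ x * character y $ z"
  by (cases "scalar_product y x"; cases "scalar_product y z")
     (simp_all add: character_def scalar_product_add_right)

lemma character_axis: "character y $ axis i 1 = (if y $ i = 0 then 1 else - 1)"
  by (simp add: character_def scalar_product_axis)

lemma character_zero: "character 0 $ x = 1"
  by (simp add: character_def scalar_product_def)

lemma character_sq: "character y $ x * character y $ x = 1"
  by (simp add: character_def)

lemma hypercube_adj_iff:
  "hypercube_adj x z \<longleftrightarrow> (\<exists>i. z = x + axis i (1 :: bit))" for x z :: "bit ^ 'n::finite"
proof
  assume "hypercube_adj x z"
  then obtain i where i: "{j. x $ j \<noteq> z $ j} = {i}"
    by (auto simp: hypercube_adj_def card_1_singleton_iff)
  have "z $ j = (x + axis i 1) $ j" for j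
  proof (cases "j = i")
    case True
    then have "x $ j \<noteq> z $ j" using i by blast
    then show ?thesis using True by (cases "x $ j"; cases "z $ j") (simp_all add: axis_def)
  next
    case False
    then have "x $ j = z $ j" using i by blast
    then show ?thesis using False by (simp add: axis_def)
  qed
  then show "\<exists>i. z = x + axis i 1" by (auto simp: vec_eq_iff)
next
  assume "\<exists>i. z = x + axis i 1"
  then obtain i where "z = x + axis i 1" ..
  then have "{j. x $ j \<noteq> z $ j} = {i}" by (auto simp: axis_def)
  then show "hypercube_adj x z" by (simp add: hypercube_adj_def)
qed

lemma laplacian_hypercube:
  "laplacian hypercube_adj f $ x = (\<Sum>i\<in>UNIV. f $ x - f $ (x + axis i 1))"
  for x :: "bit ^ 'n::finite"
proof -
  have "{z. hypercube_adj x z} = range (\<lambda>i. x + axis i 1)"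
    by (auto simp: hypercube_adj_iff)
  moreover have "inj (\<lambda>i. x + axis i (1 :: bit))"
    by (auto simp: inj_on_def axis_eq_axis)
  ultimately show ?thesis
    by (simp add: laplacian_def sum.reindex)
qed

lemma laplacian_character:
  "laplacian hypercube_adj (character y) = (2 * real (weight y)) *\<^sub>R character y"
proof -
  have "laplacian hypercube_adj (character y) $ x = 2 * real (weight y) * character y $ x" for x
  proof -
    have "laplacian hypercube_adj (character y) $ x =
        (\<Sum>i\<in>UNIV. if y $ i \<noteq> 0 then 2 * character y $ x else 0)"
      unfolding laplacian_hypercube
      by (intro sum.cong) (auto simp: character_add character_axis)
    also have "\<dots> = (\<Sum>i | y $ i \<noteq> 0. 2 * character y $ x)"
      by (simp add: sum.If_cases)
    finally show ?thesis by (simp add: weight_def)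
  qed
  then show ?thesis by (simp add: vec_eq_iff)
qed

lemma sum_character:
  "(\<Sum>y\<in>UNIV. character y $ x) = (if x = 0 then 2 ^ CARD('n) else 0)" for x :: "bit ^ 'n::finite"
proof (cases "x = 0")
  case True
  have "CARD(bit) = 2" by (simp add: UNIV_bit)
  then have "CARD(bit ^ 'n) = 2 ^ CARD('n)" by simp
  then show ?thesis using True by (simp add: character_commute[of _ 0] character_zero)
next
  case False
  then obtain i where i: "x $ i \<noteq> 0" by (auto simp: vec_eq_iff)
  let ?s = "\<Sum>y\<in>UNIV. character x $ y"
  have "?s = (\<Sum>y\<in>UNIV. character x $ (y + axis i 1))"
    by (rule sum.reindex_bij_witness[where i = "\<lambda>y. y + axis i 1" and j = "\<lambda>y. y + axis i 1"])
       (simp_all add: add.assoc bit_vec_add_self)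
  also have "\<dots> = - ?s"
    using i by (simp add: character_add character_axis sum_negf)
  finally have "?s = 0" by simp
  then show ?thesis using False by (simp add: character_commute[of _ x])
qed

lemma character_expansion:
  "f = (\<Sum>y\<in>UNIV. ((f \<bullet> character y) / 2 ^ CARD('n)) *\<^sub>R character y)"
  for f :: "real ^ (bit ^ 'n::finite)"
proof -
  have "(\<Sum>y\<in>UNIV. (f \<bullet> character y) * character y $ x) = 2 ^ CARD('n) * f $ x" for x
  proof -
    have "(\<Sum>y\<in>UNIV. (f \<bullet> character y) * character y $ x)
        = (\<Sum>y\<in>UNIV. \<Sum>z\<in>UNIV. f $ z * character y $ (z + x))"
      by (simp add: inner_vec_def sum_distrib_right character_add mult.assoc)
    also have "\<dots> = (\<Sum>z\<in>UNIV. f $ z * (\<Sum>y\<in>UNIV. character y $ (z + x)))"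
      by (subst sum.swap) (simp add: sum_distrib_left)
    also have "\<dots> = (\<Sum>z\<in>UNIV. if z = x then 2 ^ CARD('n) * f $ z else 0)"
    proof (rule sum.cong)
      fix z
      have "z + x = 0 \<longleftrightarrow> z = x"
        by (metis add_eq_0_iff2 bit_vec_neg)
      then show "f $ z * (\<Sum>y\<in>UNIV. character y $ (z + x)) = (if z = x then 2 ^ CARD('n) * f $ z else 0)"
        by (simp add: sum_character)
    qed simp
    finally show ?thesis by simp
  qed
  then show ?thesis
    by (simp add: vec_eq_iff sum_component flip: sum_divide_distrib)
qed

lemma laplacian_self_adjoint:
  "laplacian hypercube_adj f \<bullet> g = f \<bullet> laplacian hypercube_adj g"
  for f g :: "real ^ (bit ^ 'n::finite)"
proof -
  have shift: "(\<Sum>x\<in>UNIV. f $ (x + axis i 1) * g $ x) = (\<Sum>x\<in>UNIV. f $ x * g $ (x + axis i 1))" for i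
    by (rule sum.reindex_bij_witness[where i = "\<lambda>y. y + axis i 1" and j = "\<lambda>y. y + axis i 1"])
       (simp_all add: add.assoc bit_vec_add_self)
  have "laplacian hypercube_adj f \<bullet> g =
      (\<Sum>i\<in>UNIV. (\<Sum>x\<in>UNIV. f $ x * g $ x) - (\<Sum>x\<in>UNIV. f $ (x + axis i 1) * g $ x))"
    unfolding inner_vec_def laplacian_hypercube
    by (simp add: sum_distrib_right left_diff_distrib flip: sum_subtractf) (rule sum.swap)
  also have "\<dots> = f \<bullet> laplacian hypercube_adj g"
    unfolding inner_vec_def laplacian_hypercube shift
    by (simp add: sum_distrib_left right_diff_distrib flip: sum_subtractf) (rule sum.swap)
  finally show ?thesis .
qed

lemma linear_laplacian: "linear (laplacian adj)"
  by (rule linearI)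
     (simp_all add: laplacian_def vec_eq_iff sum_distrib_left right_diff_distrib add_diff_add
       flip: sum.distrib)

lemma laplacian_eigenvector_orthogonal:
  assumes "laplacian hypercube_adj f = c *\<^sub>R f" and "c \<noteq> 2 * real (weight y)"
  shows "f \<bullet> character y = 0"
  using laplacian_self_adjoint[of f "character y"] assms by (simp add: laplacian_character)

lemma hypercube_eigenvalues:
  "laplacian_eigenvalues (hypercube_adj :: bit ^ 'n::finite \<Rightarrow> _) = (\<lambda>i. 2 * real i) ` {..CARD('n)}"
proof (rule set_eqI, rule iffI)
  fix c assume "c \<in> laplacian_eigenvalues (hypercube_adj :: bit ^ 'n \<Rightarrow> _)"
  then obtain f :: "real ^ (bit ^ 'n)" where f: "f \<noteq> 0" "laplacian hypercube_adj f = c *\<^sub>R f"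
    by (auto simp: laplacian_eigenvalues_def)
  have "\<exists>y :: bit ^ 'n. c = 2 * real (weight y)"
  proof (rule ccontr)
    assume "\<not> ?thesis"
    then have "f \<bullet> character y = 0" for y
      using laplacian_eigenvector_orthogonal[OF f(2)] by blast
    then have "f = 0" by (subst character_expansion) simp
    then show False using f(1) by simp
  qed
  moreover have "weight y \<le> CARD('n)" for y :: "bit ^ 'n"
    unfolding weight_def by (rule card_mono) simp_all
  ultimately show "c \<in> (\<lambda>i. 2 * real i) ` {..CARD('n)}" by auto
next
  fix c assume "c \<in> (\<lambda>i. 2 * real i) ` {..CARD('n)}"
  then obtain i where i: "c = 2 * real i" "i \<le> CARD('n)" by auto
  obtain A :: "'n set" where A: "card A = i"
    using i(2) obtain_subset_with_card_n[of i "UNIV :: 'n set"] by blast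
  define y :: "bit ^ 'n" where "y = (\<chi> j. if j \<in> A then 1 else 0)"
  have "weight y = i"
    using A by (simp add: weight_def y_def)
  moreover have "character y \<noteq> 0"
    using character_sq[of y 0] by auto
  ultimately show "c \<in> laplacian_eigenvalues (hypercube_adj :: bit ^ 'n \<Rightarrow> _)"
    using laplacian_character[of y] i(1) by (auto simp: laplacian_eigenvalues_def)
qed

lemma hypercube_eigenvalue_nth:
  assumes "i \<le> CARD('n::finite)"
  shows "sorted_list_of_set (laplacian_eigenvalues (hypercube_adj :: bit ^ 'n \<Rightarrow> _)) ! i = 2 * real i"
proof -
  let ?l = "map (\<lambda>i. 2 * real i) [0..<Suc CARD('n)]"
  have "set ?l = laplacian_eigenvalues (hypercube_adj :: bit ^ 'n \<Rightarrow> _)"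
    unfolding hypercube_eigenvalues set_map set_upt by (auto simp: less_Suc_eq_le simp del: upt_Suc)
  moreover have "sorted ?l" "distinct ?l"
    by (auto simp: sorted_iff_nth_mono distinct_map inj_on_def simp del: upt_Suc)
  ultimately have "sorted_list_of_set (laplacian_eigenvalues (hypercube_adj :: bit ^ 'n \<Rightarrow> _)) = ?l"
    by (metis sorted_list_of_set.idem_if_sorted_distinct)
  then show ?thesis
    using assms by (simp add: nth_map del: upt_Suc)
qed

lemma hypercube_eigenspace_eq_span:
  assumes "i \<le> CARD('n::finite)"
  shows "hypercube_eigenspace i = span {character y | y :: bit ^ 'n. weight y = i}"
proof
  show "hypercube_eigenspace i \<subseteq> span {character y | y :: bit ^ 'n. weight y = i}"
  proof
    fix f :: "real ^ (bit ^ 'n)" assume "f \<in> hypercube_eigenspace i"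
    then have f: "laplacian hypercube_adj f = (2 * real i) *\<^sub>R f"
      using assms by (simp add: hypercube_eigenspace_def hypercube_eigenvalue_nth)
    have "((f \<bullet> character y) / 2 ^ CARD('n)) *\<^sub>R character y
        \<in> span {character y | y :: bit ^ 'n. weight y = i}" for y
    proof (cases "weight y = i")
      case True
      then show ?thesis by (intro span_scale span_base) auto
    next
      case False
      then show ?thesis
        using laplacian_eigenvector_orthogonal[OF f, of y] by (simp add: span_zero)
    qed
    then show "f \<in> span {character y | y :: bit ^ 'n. weight y = i}"
      by (subst character_expansion) (blast intro: span_sum)
  qed
  have "subspace (hypercube_eigenspace i :: (real ^ (bit ^ 'n)) set)"
    unfolding hypercube_eigenspace_def
    by (auto intro!: subspaceI
        simp: linear_add[OF linear_laplacian] linear_cmul[OF linear_laplacian]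
          linear_0[OF linear_laplacian] scaleR_add_right)
  moreover have "{character y | y :: bit ^ 'n. weight y = i} \<subseteq> hypercube_eigenspace i"
    using assms
    by (auto simp: hypercube_eigenspace_def hypercube_eigenvalue_nth laplacian_character)
  ultimately show "span {character y | y :: bit ^ 'n. weight y = i} \<subseteq> hypercube_eigenspace i"
    by (rule span_minimal[rotated])
qed

end

theory Submission
  imports Defs
begin

text \<open>
  Write \<open>q x\<close> for the projected point of \<open>x\<close>. Orthogonality of the characters restricted to \<open>S\<close>
  gives \<open>q x \<bullet> q z = 2\<^sup>d - 1\<close> if \<open>x + z\<close> lies in the dual code and \<open>q x \<bullet> q z = - 1\<close> otherwise. Hence the
  fibres of \<open>q\<close> are the cosets of the dual code, and the \<open>2\<^sup>d\<close> distinct points have the Gram matrix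
  of a regular simplex centred at 0. By Poisson summation the sum of a character \<open>\<chi>\<^sub>y\<close> over the dual
  code vanishes unless \<open>y \<in> S\<close>, and the only such \<open>y\<close> of weight at most \<open>t\<close> is 0.
\<close>

lemma CARD_bit_vec: "CARD(bit ^ 'n::finite) = 2 ^ CARD('n)"
proof -
  have "CARD(bit) = 2" by (simp add: UNIV_bit)
  then show ?thesis by simp
qed

text \<open>Adjoining an independent \<open>b\<close> doubles the span: the only scalars are 0 and
  1, so the new span is the old one together with its translate by \<open>b\<close>, and the two are
  disjoint.\<close>

lemma card_span_bit:
  fixes B :: "(bit ^ 'n::finite) set"
  assumes "vec.independent B"
  shows "card (vec.span B) = 2 ^ card B"
proof -
  have "finite B" by simp
  then show ?thesis using assms
  proof (induction B rule: finite_induct)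
    case empty
    then show ?case by simp
  next
    case (insert b B)
    have b: "b \<notin> vec.span B" and ind: "vec.independent B"
      using insert.prems insert.hyps by (simp_all add: vec.independent_insert)
    have "x \<in> vec.span (insert b B) \<longleftrightarrow> x \<in> vec.span B \<or> x - b \<in> vec.span B" for x
    proof -
      have "x \<in> vec.span (insert b B) \<longleftrightarrow> (\<exists>k\<in>UNIV. x - k *s b \<in> vec.span B)"
        by (simp add: vec.span_insert)
      then show ?thesis by (simp add: UNIV_bit)
    qed
    then have "vec.span (insert b B) = vec.span B \<union> (+) b ` vec.span B"
      by (fastforce simp: image_iff intro: bexI[where x = "_ - b"])
    moreover have "vec.span B \<inter> (+) b ` vec.span B = {}"
      using b by (auto simp: vec.span_add_eq2)
    ultimately have "card (vec.span (insert b B)) = card (vec.span B) + card ((+) b ` vec.span B)"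
      by (simp add: card_Un_disjoint)
    also have "\<dots> = 2 * card (vec.span B)"
      by (simp add: card_image)
    finally show ?case using insert ind by simp
  qed
qed

lemma card_subspace_bit:
  fixes S :: "(bit ^ 'n::finite) set"
  assumes "vec.subspace S"
  shows "card S = 2 ^ vec.dim S"
proof -
  obtain B where "B \<subseteq> S" "vec.independent B" "S \<subseteq> vec.span B" "card B = vec.dim S"
    using vec.basis_exists by blast
  moreover from this have "vec.span B = S"
    using assms by (simp add: vec.span_minimal subset_antisym)
  ultimately show ?thesis using card_span_bit by metis
qed

lemma character_add_left: "character (y + z) $ x = character y $ x * character z $ x"
  by (metis character_add character_commute)

lemma character_eq_1_iff: "character y $ x = 1 \<longleftrightarrow> scalar_product y x = 0"
  by (cases "scalar_product y x") (simp_all add: character_def)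

text \<open>Character values are 1 or -1, so two of them agree exactly when their product is
  1.\<close>

lemma character_eq_iff:
  "character y $ x = character y $ z \<longleftrightarrow> character y $ (x + z) = 1"
  by (cases "scalar_product y x"; cases "scalar_product y z")
     (simp_all add: character_def scalar_product_add_right)

lemma mem_dual_code_iff: "x \<in> dual_code S \<longleftrightarrow> (\<forall>y\<in>S. character y $ x = 1)"
  by (simp add: dual_code_def character_eq_1_iff scalar_product_commute)

text \<open>If some \<open>z\<close> in \<open>S\<close> has character value -1 at \<open>x\<close>,
  translation by \<open>z\<close> permutes \<open>S\<close> and negates the sum, which is therefore
  0.\<close>

lemma sum_character_subspace:
  fixes S :: "(bit ^ 'n::finite) set"
  assumes "vec.subspace S"
  shows "(\<Sum>y\<in>S. character y $ x) = (if x \<in> dual_code S then real (card S) else 0)"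
proof (cases "x \<in> dual_code S")
  case True
  then show ?thesis by (simp add: mem_dual_code_iff)
next
  case False
  then obtain z where z: "z \<in> S" "character z $ x \<noteq> 1"
    by (auto simp: mem_dual_code_iff)
  let ?s = "\<Sum>y\<in>S. character y $ x"
  have "?s = (\<Sum>y\<in>S. character (y + z) $ x)"
    by (rule sum.reindex_bij_witness[where i = "\<lambda>y. y + z" and j = "\<lambda>y. y + z"])
       (use z assms in \<open>simp_all add: add.assoc bit_vec_add_self vec.subspace_add\<close>)
  also have "\<dots> = ?s * character z $ x"
    by (simp add: character_add_left sum_distrib_right)
  finally have "?s = 0" using z by simp
  then show ?thesis using False by simp
qed

lemma sum_character_UNIV:
  "(\<Sum>x\<in>UNIV. character y $ x) = (if y = 0 then 2 ^ CARD('n) else 0)" for y :: "bit ^ 'n::finite"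
  using sum_character[of y] by (simp add: character_commute[of y])

text \<open>The sum of the characters of \<open>S\<close> is \<open>card S\<close> times the
  indicator of the dual code. Substituting it and swapping the sums leaves orthogonality of
  characters on the whole cube.\<close>

lemma poisson_summation:
  fixes S :: "(bit ^ 'n::finite) set"
  assumes "vec.subspace S"
  shows "real (card S) * (\<Sum>x\<in>dual_code S. character y $ x) = (if y \<in> S then 2 ^ CARD('n) else 0)"
proof -
  have "real (card S) * (\<Sum>x\<in>dual_code S. character y $ x)
      = (\<Sum>x\<in>UNIV. character y $ x * (\<Sum>z\<in>S. character z $ x))"
    by (simp add: sum_character_subspace[OF assms] if_distrib sum.If_cases sum_distrib_left
        mult.commute cong: if_cong)
  also have "\<dots> = (\<Sum>z\<in>S. \<Sum>x\<in>UNIV. character (y + z) $ x)"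
    unfolding sum_distrib_left character_add_left by (rule sum.swap)
  also have "\<dots> = (\<Sum>z\<in>S. if z = y then 2 ^ CARD('n) else 0)"
  proof (rule sum.cong)
    fix z
    have "y + z = 0 \<longleftrightarrow> z = y"
      by (metis add_eq_0_iff bit_vec_neg)
    then show "(\<Sum>x\<in>UNIV. character (y + z) $ x) = (if z = y then 2 ^ CARD('n) else 0)"
      by (simp add: sum_character_UNIV)
  qed simp
  finally show ?thesis by simp
qed

lemma card_dual_code:
  fixes S :: "(bit ^ 'n::finite) set"
  assumes "vec.subspace S"
  shows "card S * card (dual_code S) = 2 ^ CARD('n)"
proof -
  have "real (card S * card (dual_code S)) = real (2 ^ CARD('n))"
    using poisson_summation[OF assms, of 0] vec.subspace_0[OF assms] by (simp add: character_zero)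
  then show ?thesis by (simp only: of_nat_eq_iff)
qed

lemma dual_code_uniformly_weighted_design:
  fixes S :: "(bit ^ 'n::finite) set"
  assumes "linear_code (t + 1) S" and "t \<le> CARD('n)"
  shows "uniformly_weighted_design t (dual_code S)"
proof -
  have S: "vec.subspace S" and far: "\<And>y. y \<in> S \<Longrightarrow> y \<noteq> 0 \<Longrightarrow> t < weight y"
    using assms(1) by (auto simp: linear_code_def)
  \<comment> \<open>This is the reciprocal of the size of the dual code, the value forced by testing
    the design on constants.\<close>
  define a where "a = real (card S) / 2 ^ CARD('n)"
  \<comment> \<open>The design identity for a single \<open>f\<close>. It is linear in
    \<open>f\<close>, so checking it on the characters spanning each eigenspace suffices.\<close>
  define E where "E f \<longleftrightarrow> 1 / 2 ^ CARD('n) * (\<Sum>x\<in>UNIV. f $ x) = a * (\<Sum>w\<in>dual_code S. f $ w)"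
    for f :: "real ^ (bit ^ 'n)"
  have "card S > 0"
    using vec.subspace_0[OF S] by (auto simp: card_gt_0_iff)
  then have "a > 0" by (simp add: a_def)
  have E_subspace: "subspace (Collect E)"
    by (rule subspaceI, simp_all add: E_def sum.distrib distrib_left add_divide_distrib
        flip: sum_distrib_left) (metis mult.left_commute times_divide_eq_right)
  have E_character: "E (character y)" if "weight y \<le> t" for y
  proof -
    have "y \<in> S \<longleftrightarrow> y = 0" using far[of y] that vec.subspace_0[OF S] by auto
    then show ?thesis
      using poisson_summation[OF S, of y] by (simp add: E_def a_def sum_character_UNIV)
  qed
  have "hypercube_eigenspace i \<subseteq> Collect E" if "i \<le> t" for i
  proof -
    have "span {character y | y :: bit ^ 'n. weight y = i} \<subseteq> Collect E"
      using that E_character by (intro span_minimal[OF _ E_subspace]) auto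
    then show ?thesis
      using that assms(2) by (simp add: hypercube_eigenspace_eq_span)
  qed
  then have "(\<Sum>i\<le>t. g i) \<in> Collect E" if "\<forall>i\<le>t. g i \<in> hypercube_eigenspace i" for g
    using that by (intro subspace_sum[OF E_subspace]) blast
  then have "\<forall>f \<in> {\<Sum>i\<le>t. g i | g. \<forall>i\<le>t. g i \<in> hypercube_eigenspace i}. E f"
    by auto
  then show ?thesis
    unfolding uniformly_weighted_design_def E_def using \<open>a > 0\<close> by blast
qed

text \<open>The Gram matrix \<open>m I - J\<close>, with \<open>J\<close> the all-ones matrix, is nonsingular on the vectors with coordinate sum 0.\<close>

lemma affine_independent_if_simplex_gram:
  fixes P :: "'a::real_inner set"
  assumes "finite P" and "m \<noteq> 0"
    and "\<And>p q. p \<in> P \<Longrightarrow> q \<in> P \<Longrightarrow> p \<bullet> q = (if p = q then m else 0) - 1"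
  shows "\<not> affine_dependent P"
proof
  assume "affine_dependent P"
  then obtain U v where U: "sum U P = 0" "v \<in> P" "U v \<noteq> 0" "(\<Sum>p\<in>P. U p *\<^sub>R p) = 0"
    using affine_dependent_explicit_finite[OF assms(1)] by blast
  have "0 = (\<Sum>p\<in>P. U p *\<^sub>R p) \<bullet> v" using U by simp
  also have "\<dots> = (\<Sum>p\<in>P. (if p = v then m * U p else 0) - U p)"
    using U(2) by (auto simp: inner_sum_left assms(3) algebra_simps intro!: sum.cong)
  also have "\<dots> = m * U v"
    using U assms(1) by (simp add: sum_subtractf)
  finally show False using U assms(2) by simp
qed

theorem proposition4p10:
  fixes S :: "(bit ^ 'n::finite) set" and t d :: nat
    and \<pi> :: "real ^ (bit ^ 'n) \<Rightarrow> real ^ (bit ^ 'n)"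
    and P :: "(real ^ (bit ^ 'n)) set"
  assumes "1 \<le> t" and "t \<le> CARD('n) - 1"
    and "linear_code (t + 1) S" and "vec.dim S = d"
  defines "\<pi> \<equiv> coord_proj (S - {0})"
    and "P \<equiv> \<pi> ` set_mset (eigenconfiguration t)"
  shows "(2 ^ d - 1) simplex (convex hull P)
    \<and> {v. v extreme_point_of (convex hull P)} = P
    \<and> (\<exists>p. p extreme_point_of (convex hull P)
        \<and> {x. \<pi> (eigenpoint t x) = p} = dual_code S
        \<and> uniformly_weighted_design t {x. \<pi> (eigenpoint t x) = p}
        \<and> card {x. \<pi> (eigenpoint t x) = p} = 2 ^ (CARD('n) - d))"
proof -
  have S: "vec.subspace S" and far: "\<And>y. y \<in> S \<Longrightarrow> y \<noteq> 0 \<Longrightarrow> t < weight y"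
    using assms(3) by (auto simp: linear_code_def)
  have cardS: "card S = 2 ^ d"
    using card_subspace_bit[OF S] assms(4) by simp
  define q where "q x = \<pi> (eigenpoint t x)" for x
  \<comment> \<open>The cutoff by weight in \<open>eigenpoint\<close> has no effect here: every
    nonzero codeword has weight above \<open>t\<close>.\<close>
  have q_nth: "q x $ y = (if y \<in> S - {0} then character y $ x else 0)" for x y
    using far[of y] by (auto simp: q_def \<pi>_def coord_proj_def eigenpoint_def)
  have P: "P = range q"
    by (auto simp: P_def eigenconfiguration_def q_def)
  \<comment> \<open>Leaving out the coordinate \<open>y = 0\<close> loses no information, since
    \<open>character 0\<close> is constant.\<close>
  have q_eq_iff: "q x = q z \<longleftrightarrow> x + z \<in> dual_code S" for x z
  proof -
    have "q x $ y = q z $ y \<longleftrightarrow> (y \<in> S \<longrightarrow> character y $ x = character y $ z)" for y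
      by (cases "y = 0") (simp_all add: q_nth character_zero)
    then show ?thesis
      by (simp add: vec_eq_iff[of "q x"] mem_dual_code_iff Ball_def flip: character_eq_iff)
  qed
  \<comment> \<open>The -1 is the missing term \<open>y = 0\<close>; the full sum over
    \<open>S\<close> is \<open>2 ^ d\<close> or 0.\<close>
  have inner_q: "q x \<bullet> q z = (if q x = q z then 2 ^ d else 0) - 1" for x z
  proof -
    have "q x \<bullet> q z = (\<Sum>y\<in>S - {0}. character y $ (x + z))"
      by (simp add: inner_vec_def q_nth character_add if_distrib sum.If_cases set_diff_eq cong: if_cong)
    also have "\<dots> = (\<Sum>y\<in>S. character y $ (x + z)) - 1"
      using vec.subspace_0[OF S] by (simp add: sum_diff1 character_zero)
    finally show ?thesis
      by (simp add: sum_character_subspace[OF S] cardS q_eq_iff)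
  qed
  have indep: "\<not> affine_dependent P"
    by (rule affine_independent_if_simplex_gram[where m = "2 ^ d"]) (auto simp: P inner_q)
  \<comment> \<open>Each fibre is a coset of the dual code, and translation by \<open>z\<close> is
    its own inverse in characteristic 2.\<close>
  have fibre: "card (q -` {p}) = card (dual_code S)" if p: "p \<in> P" for p
  proof -
    obtain z where z: "p = q z" using p by (auto simp: P)
    have "bij_betw (\<lambda>x. x + z) (q -` {p}) (dual_code S)"
      by (rule bij_betw_byWitness[where f' = "\<lambda>x. x + z"])
         (auto simp: z q_eq_iff add.assoc bit_vec_add_self)
    then show ?thesis by (rule bij_betw_same_card)
  qed
  \<comment> \<open>Counting the cube fibre by fibre. Comparison with \<open>card_dual_code\<close>
    then shows that \<open>P\<close> has as many points as \<open>S\<close>.\<close>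
  have "card P * card (dual_code S) = 2 ^ CARD('n)"
  proof -
    have "CARD(bit ^ 'n) = (\<Sum>p\<in>P. card (q -` {p}))"
      using sum.image_gen[of UNIV "\<lambda>_. 1 :: nat" q] by (simp add: P vimage_def del: CARD_vec)
    then show ?thesis using fibre by (simp only: CARD_bit_vec) simp
  qed
  then have cardP: "card P = 2 ^ d"
    using card_dual_code[OF S] by (metis cardS mult_cancel2 power_not_zero zero_neq_numeral mult_0_right)
  have card_dual: "card (dual_code S) = 2 ^ (CARD('n) - d)"
  proof -
    \<comment> \<open>Makes the natural-number subtraction in the exponent exact; it holds because
      \<open>card S\<close> divides the size of the cube.\<close>
    have "d \<le> CARD('n)"
      by (rule power_dvd_imp_le[of 2]) (simp_all flip: card_dual_code[OF S] cardS)
    then have "2 ^ d * card (dual_code S) = 2 ^ d * 2 ^ (CARD('n) - d)"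
      using card_dual_code[OF S] by (simp add: cardS flip: power_add)
    then show ?thesis by simp
  qed
  \<comment> \<open>The vertex \<open>q 0\<close> is chosen because its fibre is the coset
    containing 0, the dual code itself.\<close>
  have fibre_0: "{x. \<pi> (eigenpoint t x) = q 0} = dual_code S"
    using q_eq_iff[of _ 0] by (simp add: q_def)
  have "(2 ^ d - 1) simplex (convex hull P)"
    unfolding simplex_def using indep cardP by (intro exI[of _ P]) simp
  moreover have extreme: "v extreme_point_of (convex hull P) \<longleftrightarrow> v \<in> P" for v
    using indep by (rule extreme_point_of_convex_hull_affine_independent)
  moreover have "uniformly_weighted_design t (dual_code S)"
    using assms(2,3) by (intro dual_code_uniformly_weighted_design) simp_all
  moreover have "q 0 extreme_point_of (convex hull P)"
    unfolding extreme by (simp add: P)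
  ultimately show ?thesis
    using fibre_0 card_dual by (intro conjI exI[of _ "q 0"]) simp_all
qed

end
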